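(* Let $h,\sigma\in(0,\infty)$ and $w\in\{-1,0,1\}$. Then: (I) Each of the four attainment sets $\mathcal{A}_{h,w,\sigma}$, $\mathcal{A}_{h,w,\le\sigma}$, $\mathcal{A}^{(2)}_{h,w,\sigma}$, $\mathcal{A}^{(2)}_{h,w,\le\sigma}$ coincides with the singleton set $$\{P_{\varepsilon_{h,w,\sigma},\,\sigma^2/\varepsilon_{h,w,\sigma}}\}.$$ (II) Moreover, $$\mathcal{S}_{h,w,\sigma}=\mathsf{M}_{h,w}P_{\varepsilon_{h,w,\sigma},\,\sigma^2/\varepsilon_{h,w,\sigma}}<K_w(h)\,\sigma^2,$$ where $$K_w(h):=\begin{cases} e^h-1 & \text{if } w=1,\\[2pt] \dfrac{h}{-L_{-1}(-e^{hw-1})} & \text{if } w\in\{-1,0\}.\end{cases}$$ Also, $K_0(h)=h$ for all $h\in(0,\infty)$; $K_{-1}(h)\sim h$ as $h\downarrow0$; and $K_{-1}(h)\to1$ as $h\to\infty$. (III) The constant factor $K_w(h)$ in the inequality in (II) is the best possible; that is, for each $h\in(0,\infty)$ and $w\in\{-1,0,1\}$, no constant $K<K_w(h)$ satisfies $\mathcal{S}_{h,w,\sigma}\le K\sigma^2$ for all $\sigma\in(0,\infty)$.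
   Context: Notation: $x\wedge w=\min(x,w)$. $\mathcal{P}$ is the set of all Borel probability measures on $\mathbb{R}$. For positive real $u,v$, $P_{u,v}$ denotes the unique zero-mean probability distribution on the two-point set $\{-u,v\}$; its variance is $uv$. For $h,\sigma\in(0,\infty)$ and $w\in\mathbb{R}$ define $\mathcal{P}_\sigma:=\{P\in\mathcal{P}\colon \int_{\mathbb{R}} x\,P(dx)=0,\ \int_{\mathbb{R}} x^2\,P(dx)=\sigma^2\}$, $\mathcal{P}_{\le\sigma}:=\{P\in\mathcal{P}\colon \int_{\mathbb{R}} x\,P(dx)=0,\ \int_{\mathbb{R}} x^2\,P(dx)\in(0,\sigma^2]\}$, $\mathcal{P}^{(2)}_{w,\sigma}:=\{P_{u,v}\colon -\infty<-u<w\le v<\infty,\ uv=\sigma^2\}$, $\mathcal{P}^{(2)}_{w,\le\sigma}:=\{P_{u,v}\colon -\infty<-u<w\le v<\infty,\ uv\in(0,\sigma^2]\}$ (the conditions $-u<w\le v$ and $uv>0$ force $u>0$, $v>0$). The Winsorised-tilted mean of $P$ is $$\mathsf{M}_{h,w}P:=\frac{\int_{\mathbb{R}} x e^{h(x\wedge w)}P(dx)}{\int_{\mathbb{R}} e^{h(x\wedge w)}P(dx)}.$$ The suprema $\mathcal{S}_{h,w,\sigma}$, $\mathcal{S}_{h,w,\le\sigma}$, $\mathcal{S}^{(2)}_{h,w,\sigma}$, $\mathcal{S}^{(2)}_{h,w,\le\sigma}$ are the suprema of $\mathsf{M}_{h,w}P$ over $P$ in $\mathcal{P}_\sigma$, $\mathcal{P}_{\le\sigma}$,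 $\mathcal{P}^{(2)}_{w,\sigma}$, $\mathcal{P}^{(2)}_{w,\le\sigma}$, respectively (these four suprema are in fact equal). The attainment sets $\mathcal{A}_{h,w,\sigma}$, $\mathcal{A}_{h,w,\le\sigma}$, $\mathcal{A}^{(2)}_{h,w,\sigma}$, $\mathcal{A}^{(2)}_{h,w,\le\sigma}$ are the sets of all $P$ in $\mathcal{P}_\sigma$, $\mathcal{P}_{\le\sigma}$, $\mathcal{P}^{(2)}_{w,\sigma}$, $\mathcal{P}^{(2)}_{w,\le\sigma}$, respectively, at which $\mathsf{M}_{h,w}P$ equals the corresponding supremum. Definition of $\varepsilon_{h,w,\sigma}$. For $\varepsilon\in(0,\infty)$ let $$u_*(h,\varepsilon):=\varepsilon^2\,\frac{e^{(1+\varepsilon)h}-1-\varepsilon h}{1+\varepsilon h-e^{-(1+\varepsilon)h}}.$$ Let $\sigma_h$ be the unique root in $(0,\infty)$ of the equation $u_*(h,\sigma_h^2)=\sigma_h^2$. If $\sigma>\sigma_h$, let $\tilde\varepsilon_{h,\sigma}$ be the unique root in $(0,\sigma^2)$ of the equation $u_*(h,\tilde\varepsilon_{h,\sigma})=\sigma^2$. (The existence and uniqueness of these roots, and of the one below, are established in the paper.) For $w=1$, $$\varepsilon_{h,1,\sigma}:=\begin{cases}\sigma^2 & \text{if }\sigma\le\sigma_h,\\ \tilde\varepsilon_{h,\sigma} & \text{if }\sigma>\sigma_h.\end{cases}$$ For $w\in\{-1,0\}$, $\varepsilon_{h,w,\sigma}$ is the unique root $\varepsilon\in(|w|,\infty)$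 of the equation $$e^{(\varepsilon+w)h}(1+\varepsilon h)(\varepsilon^2+\sigma^2)-\varepsilon^2e^{2(\varepsilon+w)h}-\sigma^2=0.$$ $L_{-1}$ is the branch of the Lambert product-log function such that, for each $z\in[-e^{-1},0)$, $L_{-1}(z)$ is the only root $u\in(-\infty,-1]$ of the equation $ue^u=z$. *)

theory Defs
  imports "HOL-Probability.Probability" "HOL-Library.Landau_Symbols"
begin

section \<open>Classes of distributions\<close>

definition borel_probs :: "real measure set" where
  "borel_probs = {P. prob_space P \<and> sets P = sets borel}"

text \<open>The predicate \<open>has_bochner_integral\<close> includes integrability, so that no moment condition can
  be met through the default value 0 of a divergent integral.\<close>

definition moment_class :: "real \<Rightarrow> real measure set" where
  "moment_class \<sigma> = {P \<in> borel_probs.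
     has_bochner_integral P (\<lambda>x. x) 0 \<and> has_bochner_integral P (\<lambda>x. x\<^sup>2) (\<sigma>\<^sup>2)}"

definition moment_class_le :: "real \<Rightarrow> real measure set" where
  "moment_class_le \<sigma> = {P \<in> borel_probs.
     has_bochner_integral P (\<lambda>x. x) 0 \<and>
     (\<exists>s. has_bochner_integral P (\<lambda>x. x\<^sup>2) s \<and> 0 < s \<and> s \<le> \<sigma>\<^sup>2)}"

text \<open>\<open>two_point u v\<close> is \<open>P\<^bsub>u,v\<^esub>\<close>; the description is meaningful for \<open>u, v > 0\<close>,
  see \<open>two_point_ex1\<close> below.\<close>

definition two_point :: "real \<Rightarrow> real \<Rightarrow> real measure" where
  "two_point u v = (THE P. P \<in> borel_probs \<and> measure P {-u, v} = 1 \<and>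
     has_bochner_integral P (\<lambda>x. x) 0)"

definition two_point_class :: "real \<Rightarrow> real \<Rightarrow> real measure set" where
  "two_point_class w \<sigma> = {two_point u v | u v. -u < w \<and> w \<le> v \<and> u * v = \<sigma>\<^sup>2}"

definition two_point_class_le :: "real \<Rightarrow> real \<Rightarrow> real measure set" where
  "two_point_class_le w \<sigma> =
     {two_point u v | u v. -u < w \<and> w \<le> v \<and> 0 < u * v \<and> u * v \<le> \<sigma>\<^sup>2}"


section \<open>Winsorised-tilted means, suprema and attainment sets\<close>

definition wt_mean :: "real \<Rightarrow> real \<Rightarrow> real measure \<Rightarrow> real" where
  "wt_mean h w P = (\<integral>x. x * exp (h * min x w) \<partial>P) / (\<integral>x. exp (h * min x w) \<partial>P)"

text \<open>The supremum is taken in the extended reals, since \<open>Sup\<close> on \<^typ>\<open>real\<close> is unspecified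
  for unbounded sets.\<close>

definition wt_sup :: "real \<Rightarrow> real \<Rightarrow> real measure set \<Rightarrow> ereal" where
  "wt_sup h w \<P> = (SUP P\<in>\<P>. ereal (wt_mean h w P))"

definition wt_attain :: "real \<Rightarrow> real \<Rightarrow> real measure set \<Rightarrow> real measure set" where
  "wt_attain h w \<P> = {P \<in> \<P>. ereal (wt_mean h w P) = wt_sup h w \<P>}"


section \<open>The extremal parameter and the constant factor\<close>

definition u_star :: "real \<Rightarrow> real \<Rightarrow> real" where
  "u_star h \<epsilon> =
     \<epsilon>\<^sup>2 * ((exp ((1 + \<epsilon>) * h) - 1 - \<epsilon> * h) / (1 + \<epsilon> * h - exp (- ((1 + \<epsilon>) * h))))"

definition \<sigma>_crit :: "real \<Rightarrow> real" where
  "\<sigma>_crit h = (THE \<sigma>. 0 < \<sigma> \<and> u_star h (\<sigma>\<^sup>2) = \<sigma>\<^sup>2)"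

definition \<epsilon>_tilde :: "real \<Rightarrow> real \<Rightarrow> real" where
  "\<epsilon>_tilde h \<sigma> = (THE \<epsilon>. 0 < \<epsilon> \<and> \<epsilon> < \<sigma>\<^sup>2 \<and> u_star h \<epsilon> = \<sigma>\<^sup>2)"

text \<open>\<open>\<epsilon>_opt\<close> and \<open>K_factor\<close> are intended for \<open>w \<in> {-1, 0, 1}\<close> only; their \<open>else\<close> branches are
  the case \<open>w \<in> {-1, 0}\<close>.\<close>

definition \<epsilon>_opt :: "real \<Rightarrow> real \<Rightarrow> real \<Rightarrow> real" where
  "\<epsilon>_opt h w \<sigma> =
     (if w = 1 then (if \<sigma> \<le> \<sigma>_crit h then \<sigma>\<^sup>2 else \<epsilon>_tilde h \<sigma>)
      else (THE \<epsilon>. \<bar>w\<bar> < \<epsilon> \<and>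
              exp ((\<epsilon> + w) * h) * (1 + \<epsilon> * h) * (\<epsilon>\<^sup>2 + \<sigma>\<^sup>2)
                - \<epsilon>\<^sup>2 * exp (2 * (\<epsilon> + w) * h) - \<sigma>\<^sup>2 = 0))"

text \<open>The branch \<open>L\<^bsub>-1\<^esub>\<close> of the Lambert function, meaningful for \<open>-exp (-1) \<le> z < 0\<close>.\<close>

definition lambert_m1 :: "real \<Rightarrow> real" where
  "lambert_m1 z = (THE u. u \<le> -1 \<and> u * exp u = z)"

definition K_factor :: "real \<Rightarrow> real \<Rightarrow> real" where
  "K_factor w h =
     (if w = 1 then exp h - 1 else h / (- lambert_m1 (- exp (h * w - 1))))"


section \<open>Existence and uniqueness of the two-point distribution\<close>

lemma two_point_masses:
  fixes u v :: real
  assumes "0 < u" "0 < v" and P: "P \<in> borel_probs"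
    and supp: "measure P {-u, v} = 1" and mean: "has_bochner_integral P (\<lambda>x. x) 0"
  shows "measure P {-u} = v / (u + v)" "measure P {v} = u / (u + v)"
proof -
  interpret prob_space P using P by (simp add: borel_probs_def)
  have sP [measurable_cong]: "sets P = sets borel" using P by (simp add: borel_probs_def)
  have spP: "space P = UNIV" using sets_eq_imp_space_eq[OF sP] by simp
  have ne: "-u \<noteq> v" using assms by auto
  have sing: "{-u} \<in> events" "{v} \<in> events" by (auto simp: sP)
  have "{-u, v} = {-u} \<union> {v}" by auto
  with supp have m1: "measure P {-u} + measure P {v} = 1"
    using finite_measure_Union[of "{-u}" "{v}"] sing ne by auto
  have ev: "{-u, v} \<in> events" by (simp add: sP)
  have ae: "AE x in P. x \<in> {-u, v}" using supp ev by (subst (asm) prob_eq_1) auto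
  have "0 = (\<integral>x. x \<partial>P)" using mean by (simp add: has_bochner_integral_integral_eq)
  also have "\<dots> = (\<integral>x. -u * indicator {-u} x + v * indicator {v} x \<partial>P)"
    by (rule integral_cong_AE) (use ae ne in \<open>auto simp: indicator_def\<close>)
  also have "\<dots> = -u * measure P {-u} + v * measure P {v}"
    using sing by (subst Bochner_Integration.integral_add)
      (auto simp: spP emeasure_eq_measure)
  finally have "v * measure P {v} = u * measure P {-u}" by simp
  moreover have "measure P {v} = 1 - measure P {-u}" using m1 by simp
  ultimately have "(u + v) * measure P {-u} = v" by (simp add: algebra_simps)
  then show 1: "measure P {-u} = v / (u + v)" using assms by (simp add: field_simps)
  have "v / (u + v) + u / (u + v) = 1" using assms by (simp add: add_divide_distrib[symmetric])
  then show "measure P {v} = u / (u + v)" using m1 1 by linarith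
qed

lemma two_point_ex1:
  fixes u v :: real
  assumes "0 < u" "0 < v"
  shows "\<exists>!P. P \<in> borel_probs \<and> measure P {-u, v} = 1 \<and> has_bochner_integral P (\<lambda>x. x) 0"
proof (rule ex_ex1I)
  define p where "p = u / (u + v)"
  have p: "0 \<le> p" "p \<le> 1" using assms by (auto simp: p_def)
  define f :: "bool \<Rightarrow> real" where "f = (\<lambda>b. if b then v else -u)"
  define P where "P = distr (measure_pmf (bernoulli_pmf p)) borel f"
  have f: "f \<in> measurable (measure_pmf (bernoulli_pmf p)) borel" by simp
  have "prob_space P" unfolding P_def by (rule prob_space.prob_space_distr) (auto intro: prob_space_measure_pmf)
  then have "P \<in> borel_probs" by (simp add: borel_probs_def P_def)
  moreover have "f -` {-u, v} = UNIV" by (auto simp: f_def)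
  then have "measure P {-u, v} = 1" unfolding P_def by (subst measure_distr) auto
  moreover have "integrable P (\<lambda>x. x)" unfolding P_def
    by (subst integrable_distr_eq[OF f]) (auto intro: integrable_measure_pmf_finite)
  moreover have "(\<integral>x. x \<partial>P) = 0" unfolding P_def
    using p assms by (subst integral_distr[OF f]) (auto simp: f_def p_def field_simps)
  ultimately show "\<exists>P. P \<in> borel_probs \<and> measure P {-u, v} = 1 \<and> has_bochner_integral P (\<lambda>x. x) 0"
    by (auto simp: has_bochner_integral_iff)
next
  fix P Q :: "real measure"
  assume P: "P \<in> borel_probs \<and> measure P {-u, v} = 1 \<and> has_bochner_integral P (\<lambda>x. x) 0"
    and Q: "Q \<in> borel_probs \<and> measure Q {-u, v} = 1 \<and> has_bochner_integral Q (\<lambda>x. x) 0"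
  have eq: "measure R A = indicator A (-u) * (v / (u + v)) + indicator A v * (u / (u + v))"
    if R: "R \<in> borel_probs \<and> measure R {-u, v} = 1 \<and> has_bochner_integral R (\<lambda>x. x) 0"
      and A: "A \<in> sets borel" for R :: "real measure" and A
  proof -
    interpret prob_space R using R by (simp add: borel_probs_def)
    have sR: "sets R = sets borel" using R by (simp add: borel_probs_def)
    have ev: "{-u, v} \<in> events" by (simp add: sR)
    have ae: "AE x in R. x \<in> {-u, v}" using R ev by (auto simp: prob_eq_1)
    have ne: "-u \<noteq> v" using assms by auto
    have "measure R A = measure R (A \<inter> {-u, v})"
      using ae A by (intro finite_measure_eq_AE) (auto simp: sR)
    also have "A \<inter> {-u, v} = (A \<inter> {-u}) \<union> (A \<inter> {v})" by auto
    also have "measure R \<dots> = measure R (A \<inter> {-u}) + measure R (A \<inter> {v})"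
      using A ne by (intro finite_measure_Union) (auto simp: sR)
    also have "measure R (A \<inter> {-u}) = indicator A (-u) * measure R {-u}" by (cases "-u \<in> A") auto
    also have "measure R (A \<inter> {v}) = indicator A v * measure R {v}" by (cases "v \<in> A") auto
    finally show ?thesis using two_point_masses[OF assms] R by metis
  qed
  show "P = Q"
  proof (rule measure_eqI)
    show s: "sets P = sets Q" using P Q by (simp add: borel_probs_def)
    fix A assume "A \<in> sets P"
    then have A: "A \<in> sets borel" using P by (simp add: borel_probs_def)
    interpret P: prob_space P using P by (simp add: borel_probs_def)
    interpret Q: prob_space Q using Q by (simp add: borel_probs_def)
    show "emeasure P A = emeasure Q A"
      using eq[OF P A] eq[OF Q A] by (simp add: P.emeasure_eq_measure Q.emeasure_eq_measure)
  qed
qed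

end

theory Submission
  imports Defs "HOL-Real_Asymp.Real_Asymp"
begin

text \<open>
  The proof is linear programming duality. A bound \<open>wt_mean h w P \<le> M\<close> says that
  \<open>(x - M) exp (h (x \<and> w))\<close> has nonpositive expectation. For all \<open>P\<close> with mean zero and variance
  at most \<open>\<sigma>\<^sup>2\<close> this follows from a pointwise majorant \<open>c (x\<^sup>2 - \<sigma>\<^sup>2) + b x\<close> with \<open>c > 0\<close>. If
  the majorant touches at exactly two points \<open>-u\<close> and \<open>v\<close> with \<open>u v = \<sigma>\<^sup>2\<close>, then equality forces
  \<open>P\<close> to be supported there, and so to be \<open>two_point u v\<close>. The lemma \<open>dual_certificate\<close> produces
  this majorant whenever \<open>u\<close> is stationary for the tilted mean along \<open>u v = \<sigma>\<^sup>2\<close>, or when \<open>v\<close> is at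
  the kink \<open>w\<close> and the derivative has the right sign; \<open>two_point_optimal\<close> draws the conclusion. As
  the optimal distribution is the same for the largest of the four classes and lies in the smallest,
  it is optimal in each of them.

  The stationarity equation is the one that defines \<open>\<epsilon>_opt\<close>. The intermediate value theorem gives a
  root, and the uniqueness of the optimal distribution shows that there is only one
  (\<open>extremal_unique\<close>). The only separate uniqueness argument is the one for \<open>\<sigma>_crit\<close>, where the
  variance varies together with the unknown; there \<open>u_star h u / u\<close> is strictly increasing.

  Divided by the variance, the tilted mean of \<open>two_point u v\<close> is an explicit function of \<open>u\<close> and
  \<open>v\<close> that decreases in \<open>v\<close>. Its supremum over the admissible \<open>u\<close> and \<open>v\<close> is \<open>K_factor w h\<close>,
  by the inequality \<open>1 + x \<le> exp x\<close>, and it is approached only in a limit. This gives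
  both the strict bound (\<open>two_point_mean_less_K_factor\<close>) and its sharpness (\<open>K_factor_sharp\<close>).
\<close>

section \<open>Two-point distributions\<close>

lemma two_point_props:
  assumes "0 < u" "0 < v"
  shows "two_point u v \<in> borel_probs" "measure (two_point u v) {-u, v} = 1"
    "has_bochner_integral (two_point u v) (\<lambda>x. x) 0"
  using theI'[OF two_point_ex1[OF assms]] unfolding two_point_def by auto

lemma two_point_eqI:
  assumes "0 < u" "0 < v" and P: "P \<in> borel_probs"
    and AE: "AE x in P. x \<in> {-u, v}" and mean: "has_bochner_integral P (\<lambda>x. x) 0"
  shows "P = two_point u v"
proof -
  interpret prob_space P using P by (simp add: borel_probs_def)
  have "measure P {-u, v} = 1"
    using AE P by (subst prob_eq_1) (auto simp: borel_probs_def)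
  then show ?thesis
    using the1_equality[OF two_point_ex1[OF assms(1,2)], of P] P mean by (simp add: two_point_def)
qed

lemma has_bochner_integral_two_point:
  fixes g :: "real \<Rightarrow> real"
  assumes uv: "0 < u" "0 < v" and g: "g \<in> borel_measurable borel"
  shows "has_bochner_integral (two_point u v) g ((v * g (-u) + u * g v) / (u + v))"
proof -
  let ?P = "two_point u v"
  note P = two_point_props[OF uv]
  interpret prob_space ?P using P by (simp add: borel_probs_def)
  have sP [measurable_cong]: "sets ?P = sets borel" using P by (simp add: borel_probs_def)
  have spP: "space ?P = UNIV" using sets_eq_imp_space_eq[OF sP] by simp
  have gP: "g \<in> borel_measurable ?P" using g by simp
  have ne: "-u \<noteq> v" using uv by auto
  have ae: "AE x in ?P. x \<in> {-u, v}" using P(2) by (subst (asm) prob_eq_1) (auto simp: sP)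
  have "has_bochner_integral ?P
      (\<lambda>x. g (-u) * indicator {-u} x + g v * indicator {v} x)
      (g (-u) * measure ?P {-u} + g v * measure ?P {v})"
    by (intro has_bochner_integral_add has_bochner_integral_mult_right
        has_bochner_integral_real_indicator) (simp_all add: sP emeasure_eq_measure)
  moreover have "g (-u) * measure ?P {-u} + g v * measure ?P {v} = (v * g (-u) + u * g v) / (u + v)"
    using two_point_masses[OF uv P] by (simp add: add_divide_distrib mult.commute)
  moreover have "AE x in ?P. g x = g (-u) * indicator {-u} x + g v * indicator {v} x"
    using ae ne by (auto simp: indicator_def)
  moreover have "(\<lambda>x. g (-u) * indicator {-u} x + g v * indicator {v} x) \<in> borel_measurable ?P"
    by measurable
  ultimately show ?thesis
    using has_bochner_integral_cong_AE gP by metis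
qed

lemma two_point_inject:
  assumes uv: "0 < u" "0 < v" and uv': "0 < u'" "0 < v'"
    and eq: "two_point u v = two_point u' v'"
  shows "u = u'"
proof -
  let ?P = "two_point u v"
  note P = two_point_props[OF uv] and P' = two_point_props[OF uv', folded eq]
  interpret prob_space ?P using P by (simp add: borel_probs_def)
  have "{-u} \<inter> {-u', v'} \<noteq> {}"
  proof
    assume disj: "{-u} \<inter> {-u', v'} = {}"
    have "measure ?P ({-u} \<union> {-u', v'}) = measure ?P {-u} + measure ?P {-u', v'}"
      using P disj by (intro finite_measure_Union) (auto simp: borel_probs_def)
    moreover have "measure ?P {-u} > 0" using two_point_masses(1)[OF uv P] uv by simp
    ultimately show False using P'(2) prob_le_1[of "{-u} \<union> {-u', v'}"] by linarith
  qed
  then show ?thesis using uv uv' by auto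
qed

lemma two_point_in_moment_class:
  assumes uv: "0 < u" "0 < v" "u * v = \<sigma>\<^sup>2"
  shows "two_point u v \<in> moment_class \<sigma>"
proof -
  have val: "(v * (-u)\<^sup>2 + u * v\<^sup>2) / (u + v) = \<sigma>\<^sup>2"
  proof -
    have "v * (-u)\<^sup>2 + u * v\<^sup>2 = (u * v) * (u + v)" by (simp add: power2_eq_square algebra_simps)
    then show ?thesis using uv by simp
  qed
  have "(\<lambda>x::real. x\<^sup>2) \<in> borel_measurable borel" by measurable
  from has_bochner_integral_two_point[OF uv(1,2) this]
  have "has_bochner_integral (two_point u v) (\<lambda>x. x\<^sup>2) (\<sigma>\<^sup>2)"
    unfolding val .
  then show ?thesis
    unfolding moment_class_def using two_point_props[OF uv(1,2)] by blast
qed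

definition two_point_mean :: "real \<Rightarrow> real \<Rightarrow> real \<Rightarrow> real \<Rightarrow> real" where
  "two_point_mean h w u v = u * v * (exp (h * (u + w)) - 1) / (v + u * exp (h * (u + w)))"

lemma wt_mean_two_point:
  assumes uv: "0 < u" "0 < v" and w: "-u < w" "w \<le> v"
  shows "wt_mean h w (two_point u v) = two_point_mean h w u v"
proof -
  have m: "min (-u) w = -u" "min v w = w" using w by auto
  have 1: "(\<integral>x. x * exp (h * min x w) \<partial>two_point u v)
      = (v * (-u * exp (h * (-u))) + u * (v * exp (h * w))) / (u + v)"
    using has_bochner_integral_two_point[OF uv, of "\<lambda>x. x * exp (h * min x w)"] m
    by (simp add: has_bochner_integral_iff)
  have 2: "(\<integral>x. exp (h * min x w) \<partial>two_point u v)
      = (v * exp (h * (-u)) + u * exp (h * w)) / (u + v)"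
    using has_bochner_integral_two_point[OF uv, of "\<lambda>x. exp (h * min x w)"] m
    by (simp add: has_bochner_integral_iff)
  have "wt_mean h w (two_point u v)
      = (v * (-u * exp (h * (-u))) + u * (v * exp (h * w))) / (v * exp (h * (-u)) + u * exp (h * w))"
    unfolding wt_mean_def 1 2 using uv by simp
  also have "\<dots> = (exp (h * u) * (v * (-u * exp (h * (-u))) + u * (v * exp (h * w))))
      / (exp (h * u) * (v * exp (h * (-u)) + u * exp (h * w)))" by simp
  also have "exp (h * u) * (v * (-u * exp (h * (-u))) + u * (v * exp (h * w)))
      = u * v * (exp (h * (u + w)) - 1)"
    by (simp add: algebra_simps exp_minus exp_add)
  also have "exp (h * u) * (v * exp (h * (-u)) + u * exp (h * w)) = v + u * exp (h * (u + w))"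
    by (simp add: algebra_simps exp_minus exp_add)
  finally show ?thesis by (simp add: two_point_mean_def)
qed

section \<open>The dual certificate\<close>

text \<open>Up to a positive factor this is minus the derivative of \<open>u \<mapsto> two_point_mean h w u (s / u)\<close>, the
  tilted mean along the two-point distributions of variance \<open>s\<close>. Its zeros are the candidates for
  the optimal \<open>u\<close>, and for \<open>w = 1\<close> the positive ones are the positive solutions of \<open>u_star h u = s\<close>.\<close>

definition gap :: "real \<Rightarrow> real \<Rightarrow> real \<Rightarrow> real \<Rightarrow> real" where
  "gap h w s u = u\<^sup>2 * exp (h * (u + w)) * (exp (h * (u + w)) - 1 - h * u)
     - s * (exp (h * (u + w)) - 1 + h * u * exp (h * (u + w)))"

text \<open>The second derivative of the difference \<open>D\<close> stays negative once it is not positive, so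
  \<open>D\<close> is convex up to some point and concave from there on. On the convex part \<open>D\<close> lies above its
  tangent at \<open>-u\<close>, which is zero; on the concave part it lies above the smaller of its values at
  the two ends. The point \<open>-u\<close> belongs to the convex part because otherwise
  \<open>D w < 0\<close>.\<close>

lemma quadratic_minus_tilt_pos:
  fixes b c s h M u w :: real
  assumes h: "0 < h" and c: "0 < c" and uw: "-u < w"
    and D_def: "\<And>x. D x = c * (x\<^sup>2 - s) + b * x - (x - M) * exp (h * x)"
    and D1_def: "\<And>x. D1 x = 2 * c * x + b - (1 + h * (x - M)) * exp (h * x)"
    and D0: "D (-u) = 0" and D10: "D1 (-u) = 0" and Dw: "0 \<le> D w"
    and x: "x < w" "x \<noteq> -u"
  shows "0 < D x"
proof -
  define D2 where "D2 = (\<lambda>x. 2 * c - h * (2 + h * (x - M)) * exp (h * x))"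
  have DD: "(D has_real_derivative D1 x) (at x)" for x
    unfolding D_def[abs_def] D1_def by (auto intro!: derivative_eq_intros simp: algebra_simps)
  have DD1: "(D1 has_real_derivative D2 x) (at x)" for x
    unfolding D1_def[abs_def] D2_def by (auto intro!: derivative_eq_intros simp: algebra_simps)
  \<comment> \<open>Second-order Taylor expansion with Lagrange remainder.\<close>
  have taylor: "\<exists>z. min a y < z \<and> z < max a y \<and> D y = D a + D1 a * (y - a) + D2 z / 2 * (y - a)\<^sup>2"
    if "a \<noteq> y" for a y
  proof -
    define diff where "diff = (\<lambda>n::nat. if n = 0 then D else if n = 1 then D1 else D2)"
    have "\<exists>t. (if y < a then y < t \<and> t < a else a < t \<and> t < y) \<and>
      D y = (\<Sum>m<2. diff m a / fact m * (y - a) ^ m) + diff 2 t / fact 2 * (y - a) ^ 2"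
      by (rule Taylor[where a = "min a y" and b = "max a y"])
        (use that DD DD1 in \<open>auto simp: diff_def less_2_cases_iff\<close>)
    then show ?thesis by (auto simp: diff_def eval_nat_numeral split: if_splits)
  qed
  \<comment> \<open>From convex the difference can turn concave, but never back.\<close>
  have up: "D2 z < 0" if "D2 y \<le> 0" "y < z" for y z
  proof -
    have "0 < h * (2 + h * (y - M)) * exp (h * y)" using that c by (simp add: D2_def)
    then have pos: "0 < 2 + h * (y - M)" using h by (simp add: zero_less_mult_iff)
    have lt: "2 + h * (y - M) < 2 + h * (z - M)" using h that by simp
    have "(2 + h * (y - M)) * exp (h * y) < (2 + h * (z - M)) * exp (h * z)"
      using pos order.strict_trans[OF pos lt] h that by (intro mult_strict_mono lt) auto
    then have "h * ((2 + h * (y - M)) * exp (h * y)) < h * ((2 + h * (z - M)) * exp (h * z))"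
      using h by simp
    then show ?thesis using that by (simp add: D2_def mult.assoc)
  qed
  have convex_at: "0 < D2 (-u)"
  proof (rule ccontr)
    assume "\<not> 0 < D2 (-u)"
    moreover obtain z where "-u < z" "D w = D2 z / 2 * (w + u)\<^sup>2"
      using taylor[of "-u" w] uw D0 D10 by auto
    ultimately have "D2 z / 2 < 0" "D w = D2 z / 2 * (w + u)\<^sup>2" using up[of "-u" z] by auto
    moreover have "0 < (w + u)\<^sup>2" using uw by simp
    ultimately have "D w < 0" by (metis mult_neg_pos)
    then show False using Dw by simp
  qed
  have pos_of_convex: "0 < D y" if y: "0 < D2 y" "y \<noteq> -u" for y
  proof -
    obtain z where z: "min (-u) y < z" "z < max (-u) y" "D y = D2 z / 2 * (y + u)\<^sup>2"
      using taylor[of "-u" y] y D0 D10 by auto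
    have "0 < D2 z" using up[of z "max (-u) y"] z y convex_at by (force simp: max_def split: if_splits)
    moreover have "0 < (y + u)\<^sup>2" using y by (simp add: add_eq_0_iff)
    ultimately show ?thesis using z(3) by (simp only: mult_pos_pos half_gt_zero)
  qed
  show ?thesis
  proof (cases "0 < D2 x")
    case True
    then show ?thesis using pos_of_convex x by blast
  next
    case False
    then have ux: "-u < x" using up[of x "-u"] convex_at x by force
    show ?thesis
    proof (cases "D1 x \<le> 0")
      case True
      obtain z where z: "x < z" "D w = D x + D1 x * (w - x) + D2 z / 2 * (w - x)\<^sup>2"
        using taylor[of x w] x by auto
      have "D2 z / 2 * (w - x)\<^sup>2 < 0" using up[of x z] False z x by (auto simp: mult_neg_pos)
      moreover have "D1 x * (w - x) \<le> 0" using True x by (simp add: mult_nonpos_nonneg)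
      ultimately show ?thesis using z Dw by linarith
    next
      case d1: False
      have D1pos: "0 < D1 y" if y: "-u < y" "y < x" for y
      proof (cases "0 < D2 y")
        case True
        obtain z where z: "-u < z" "z < y" "D1 y - D1 (-u) = (y - (-u)) * D2 z"
          using MVT2[of "-u" y D1 D2] DD1 y by blast
        have "0 < D2 z" using up[of z y] True z by force
        then show ?thesis using z y D10 by simp
      next
        case D2: False
        obtain z where z: "y < z" "z < x" "D1 x - D1 y = (x - y) * D2 z"
          using MVT2[of y x D1 D2] DD1 y by blast
        have "D2 z < 0" using up[of y z] D2 z by force
        then have "(x - y) * D2 z < 0" using y by (simp add: mult_pos_neg)
        then show ?thesis using z d1 by linarith
      qed
      obtain z where z: "-u < z" "z < x" "D x - D (-u) = (x - (-u)) * D1 z"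
        using MVT2[of "-u" x D D1] DD ux by blast
      then show ?thesis using D1pos[of z] D0 ux by simp
    qed
  qed
qed

text \<open>This is weak duality for the moment problem. For mean zero and variance at most
  \<open>u v\<close> the tilted mean is bounded by \<open>M\<close> as soon as \<open>(x - M) exp (h (x \<and> w))\<close> has a
  majorant \<open>c (x\<^sup>2 - u v) + b x\<close> with \<open>c \<ge> 0\<close>, since such a majorant has expectation at most
  zero. The multipliers \<open>b\<close> and \<open>c\<close> are forced by tangency at \<open>-u\<close>. Contact at \<open>v\<close> is then automatic,
  because both sides have expectation zero under the two-point distribution. What remains is the
  slope at \<open>v\<close>: on the linear branch \<open>x \<ge> w\<close> tangency is needed if \<open>v > w\<close>, while at the kink
  \<open>v = w\<close> the slope of the quadratic only has to be large enough. The sign of \<open>gap\<close> decides this.\<close>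

lemma dual_certificate:
  fixes h u v w :: real
  assumes h: "0 < h" and uv: "0 < u" "0 < v" and w: "-u < w" "w \<le> v"
    and gap: "gap h w (u * v) u \<le> 0" "v = w \<or> gap h w (u * v) u = 0"
  defines "M \<equiv> two_point_mean h w u v"
  obtains b c where "0 < c"
    "\<And>x. (x - M) * exp (h * min x w) \<le> c * (x\<^sup>2 - u * v) + b * x"
    "\<And>x. (x - M) * exp (h * min x w) = c * (x\<^sup>2 - u * v) + b * x \<Longrightarrow> x \<in> {-u, v}"
proof -
  define e A where "e = exp (- (h * u))" and "A = exp (h * w)"
  have eA: "0 < e" "0 < A" by (auto simp: e_def A_def)
  have E: "exp (h * (u + w)) = A / e"
    by (simp add: e_def A_def exp_minus exp_add field_simps)
  have den: "0 < v * e + u * A" using uv eA by (simp add: add_pos_pos)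
  have M: "M * (v * e + u * A) = u * v * (A - e)"
  proof -
    have "M = u * v * (A / e - 1) / (v + u * (A / e))" by (simp add: M_def two_point_mean_def E)
    also have "\<dots> = (e * (u * v * (A / e - 1))) / (e * (v + u * (A / e)))" using eA by simp
    also have "e * (u * v * (A / e - 1)) = u * v * (A - e)" using eA by (simp add: field_simps)
    also have "e * (v + u * (A / e)) = v * e + u * A" using eA by (simp add: field_simps)
    finally show ?thesis using den by simp
  qed
  have "h * (-u) < h * w" using h w by (intro mult_strict_left_mono) auto
  then have "e < A" by (simp add: e_def A_def)
  then have "0 < M * (v * e + u * A)" unfolding M using uv by simp
  then have Mpos: "0 < M" using den by (simp add: zero_less_mult_iff)
  define c where "c = e * (M + h * u * (u + M)) / (u * (u + v))"
  define b where "b = 2 * c * u + e * (1 - h * (u + M))"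
  \<comment> \<open>The slope of the quadratic at \<open>v\<close> minus the slope \<open>A\<close> of the linear branch.\<close>
  define \<delta> where "\<delta> = 2 * c * v + b - A"
  have cpos: "0 < c" unfolding c_def using uv eA h Mpos by (simp add: add_pos_pos)
  have ceq: "c * (u * (u + v)) = e * (M + h * u * (u + M))" unfolding c_def using uv by simp
  have contact_u: "c * ((-u)\<^sup>2 - u * v) + b * (-u) = (-u - M) * e"
  proof -
    have "c * ((-u)\<^sup>2 - u * v) + b * (-u) = - (c * (u * (u + v))) - u * (e * (1 - h * (u + M)))"
      by (simp add: b_def power2_eq_square algebra_simps)
    then show ?thesis unfolding ceq by (simp add: algebra_simps)
  qed
  have contact_v: "c * (v\<^sup>2 - u * v) + b * v = (v - M) * A"
  proof -
    have "u * (c * (v\<^sup>2 - u * v) + b * v) = - v * (c * ((-u)\<^sup>2 - u * v) + b * (-u))"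
      by (simp add: power2_eq_square algebra_simps)
    also have "\<dots> = u * ((v - M) * A)" unfolding contact_u using M by (simp add: algebra_simps)
    finally show ?thesis using uv by simp
  qed
  have \<delta>: "\<delta> * (v * e + u * A) * u = - (e\<^sup>2 * gap h w (u * v) u)"
  proof -
    have "\<delta> * u = 2 * (c * (u * (u + v))) + u * (e * (1 - h * (u + M))) - A * u"
      by (simp add: \<delta>_def b_def algebra_simps)
    also have "\<dots> = e * (2 + h * u) * M + (e * (u + h * u\<^sup>2) - A * u)"
      unfolding ceq by (simp add: algebra_simps power2_eq_square)
    finally have \<delta>u: "\<delta> * u = e * (2 + h * u) * M + (e * (u + h * u\<^sup>2) - A * u)" .
    have "\<delta> * u * (v * e + u * A)
        = e * (2 + h * u) * (M * (v * e + u * A)) + (e * (u + h * u\<^sup>2) - A * u) * (v * e + u * A)"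
      unfolding \<delta>u by (simp only: distrib_right mult.assoc)
    then have "\<delta> * u * (v * e + u * A) = u * v * (A * e - e\<^sup>2 + h * u * A * e) - u\<^sup>2 * A * (A - e - h * u * e)"
      unfolding M by (simp add: algebra_simps power2_eq_square)
    moreover have "e\<^sup>2 * gap h w (u * v) u = u\<^sup>2 * A * (A - e - h * u * e) - u * v * (A * e - e\<^sup>2 + h * u * A * e)"
      unfolding gap_def E using eA by (simp add: field_simps power2_eq_square)
    ultimately show ?thesis by (simp add: algebra_simps)
  qed
  have \<delta>_nonneg: "0 \<le> \<delta>"
  proof -
    have "0 \<le> \<delta> * ((v * e + u * A) * u)" using \<delta> gap(1) eA by (simp add: mult_nonneg_nonpos mult.assoc)
    moreover have "0 < (v * e + u * A) * u" using den uv by simp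
    ultimately show ?thesis by (meson mult_neg_pos not_less)
  qed
  have \<delta>_zero: "v = w \<or> \<delta> = 0" using gap(2) \<delta> den uv by auto
  have right: "c * (x\<^sup>2 - u * v) + b * x - (x - M) * A = c * (x - v)\<^sup>2 + \<delta> * (x - v)" for x
  proof -
    have "c * (x\<^sup>2 - u * v) + b * x - (x - M) * A
        = (c * (v\<^sup>2 - u * v) + b * v - (v - M) * A) + (c * (x - v)\<^sup>2 + \<delta> * (x - v))"
      by (simp add: \<delta>_def algebra_simps power2_eq_square)
    then show ?thesis using contact_v by simp
  qed
  define D where "D = (\<lambda>x. c * (x\<^sup>2 - u * v) + b * x - (x - M) * exp (h * x))"
  define D1 where "D1 = (\<lambda>x. 2 * c * x + b - (1 + h * (x - M)) * exp (h * x))"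
  have left: "0 < D x" if "x < w" "x \<noteq> -u" for x
  proof (rule quadratic_minus_tilt_pos[where c = c and D = D and ?D1.0 = D1 and u = u and w = w and h = h
        and M = M and b = b and s = "u * v"])
    show "D (-u) = 0" using contact_u by (simp add: D_def e_def)
    show "D1 (-u) = 0" unfolding D1_def b_def by (simp add: e_def algebra_simps)
    show "0 \<le> D w" using right[of w] \<delta>_zero cpos by (auto simp: D_def A_def)
  qed (use that h cpos w in \<open>auto simp: D_def D1_def\<close>)
  have *: "0 \<le> c * (x\<^sup>2 - u * v) + b * x - (x - M) * exp (h * min x w) \<and>
     (c * (x\<^sup>2 - u * v) + b * x - (x - M) * exp (h * min x w) = 0 \<longrightarrow> x \<in> {-u, v})" for x
  proof (cases "x < w")
    case True
    then have "min x w = x" by simp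
    moreover have "D x = 0" if "x = -u" using contact_u that by (simp add: D_def e_def)
    ultimately show ?thesis using left[OF True] by (cases "x = -u") (auto simp: D_def)
  next
    case False
    then have m: "min x w = w" by simp
    have "0 \<le> \<delta> * (x - v)" using \<delta>_zero \<delta>_nonneg False by (auto simp: zero_le_mult_iff)
    moreover have "0 \<le> c * (x - v)\<^sup>2" "x \<noteq> v \<longrightarrow> 0 < c * (x - v)\<^sup>2" using cpos by auto
    ultimately have "0 \<le> c * (x - v)\<^sup>2 + \<delta> * (x - v)"
      "x \<noteq> v \<longrightarrow> 0 < c * (x - v)\<^sup>2 + \<delta> * (x - v)" by linarith+
    then show ?thesis unfolding m A_def[symmetric] right by auto
  qed
  show thesis by (rule that[OF cpos, of b]) (use * in force)+
qed

text \<open>Integrating the certificate gives the bound. If the bound is attained, the majorant and the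
  tilted line agree almost everywhere, hence \<open>P\<close> lives on the two contact points, and its zero mean
  determines the masses.\<close>

lemma two_point_optimal:
  fixes h u v w \<sigma> :: real
  assumes h: "0 < h" and uv: "0 < u" "0 < v" and w: "-u < w" "w \<le> v"
    and gap: "gap h w (u * v) u \<le> 0" "v = w \<or> gap h w (u * v) u = 0"
    and \<sigma>: "u * v = \<sigma>\<^sup>2" and P: "P \<in> moment_class_le \<sigma>"
  shows "wt_mean h w P \<le> two_point_mean h w u v"
    and "wt_mean h w P = two_point_mean h w u v \<Longrightarrow> P = two_point u v"
proof -
  define M where "M = two_point_mean h w u v"
  obtain b c where c: "0 < c"
    and le: "\<And>x. (x - M) * exp (h * min x w) \<le> c * (x\<^sup>2 - u * v) + b * x"
    and eq: "\<And>x. (x - M) * exp (h * min x w) = c * (x\<^sup>2 - u * v) + b * x \<Longrightarrow> x \<in> {-u, v}"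
    by (rule dual_certificate[OF h uv w gap, folded M_def], rule that)
  obtain s where PB: "P \<in> borel_probs" and mean: "has_bochner_integral P (\<lambda>x. x) 0"
    and var: "has_bochner_integral P (\<lambda>x. x\<^sup>2) s" and s: "s \<le> \<sigma>\<^sup>2"
    using P by (auto simp: moment_class_le_def)
  interpret prob_space P using PB by (simp add: borel_probs_def)
  have sP [measurable_cong]: "sets P = sets borel" using PB by (simp add: borel_probs_def)
  have bd: "exp (h * min x w) \<le> exp (h * w)" for x using h by simp
  have D_int: "integrable P (\<lambda>x. exp (h * min x w))"
    by (rule integrable_const_bound[of _ "exp (h * w)"]) (use bd in auto)
  have N_int: "integrable P (\<lambda>x. x * exp (h * min x w))"
  proof (rule Bochner_Integration.integrable_bound[of _ "\<lambda>x. exp (h * w) * x"])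
    show "integrable P (\<lambda>x. exp (h * w) * x)" using mean by (simp add: has_bochner_integral_iff)
    show "AE x in P. norm (x * exp (h * min x w)) \<le> norm (exp (h * w) * x)"
    proof (rule AE_I2)
      fix x show "norm (x * exp (h * min x w)) \<le> norm (exp (h * w) * x)"
        using mult_left_mono[OF bd[of x], of "\<bar>x\<bar>"] by (simp add: abs_mult mult.commute)
    qed
  qed measurable
  define N D where "N = (\<integral>x. x * exp (h * min x w) \<partial>P)" and "D = (\<integral>x. exp (h * min x w) \<partial>P)"
  have Dpos: "0 < D"
  proof -
    have "D \<noteq> 0" unfolding D_def
      using D_int by (subst integral_nonneg_eq_0_iff_AE) (auto simp: AE_False)
    moreover have "0 \<le> D" unfolding D_def by simp
    ultimately show ?thesis by simp
  qed
  define r where "r = (\<lambda>x. c * (x\<^sup>2 - u * v) + b * x - (x * exp (h * min x w) - M * exp (h * min x w)))"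
  have r_nonneg: "0 \<le> r x" for x using le[of x] by (simp add: r_def algebra_simps)
  have "has_bochner_integral P r (c * (s - u * v) + b * 0 - (N - M * D))"
  proof -
    have k: "has_bochner_integral P (\<lambda>x. u * v) (u * v)"
      by (simp add: has_bochner_integral_iff prob_space)
    show ?thesis unfolding r_def N_def D_def
      by (intro has_bochner_integral_diff has_bochner_integral_add has_bochner_integral_mult_right
          mean var k has_bochner_integral_integrable D_int N_int) 
  qed
  then have r_int: "integrable P r" and r_val: "integral\<^sup>L P r = c * (s - u * v) - (N - M * D)"
    by (auto simp: has_bochner_integral_iff)
  have r_le: "integral\<^sup>L P r \<le> M * D - N"
    unfolding r_val using c s \<sigma> by (simp add: mult_nonneg_nonpos)
  have "0 \<le> integral\<^sup>L P r" using r_nonneg by simp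
  then have "N \<le> M * D" using r_le by simp
  moreover have wm: "wt_mean h w P = N / D" by (simp add: wt_mean_def N_def D_def)
  ultimately show "wt_mean h w P \<le> two_point_mean h w u v"
    using Dpos by (simp add: M_def divide_le_eq)
  assume "wt_mean h w P = two_point_mean h w u v"
  then have "N = M * D" using wm Dpos by (simp add: M_def field_simps)
  then have "integral\<^sup>L P r = 0" using r_le \<open>0 \<le> integral\<^sup>L P r\<close> by simp
  then have "AE x in P. r x = 0" using r_int r_nonneg by (subst (asm) integral_nonneg_eq_0_iff_AE) auto
  then have "AE x in P. x \<in> {-u, v}"
    by eventually_elim (rule eq, simp add: r_def algebra_simps)
  then show "P = two_point u v" by (rule two_point_eqI[OF uv PB _ mean])
qed

section \<open>Roots of the stationarity equation\<close>

text \<open>This identity transfers both the root and the sign of \<open>u_star h u - s\<close> to \<open>gap\<close>, which is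
  continuous on the whole line and so convenient for the intermediate value theorem.\<close>

lemma u_star_gap:
  assumes "0 < h" "0 < u"
  obtains d where "0 < d" "\<And>s. gap h 1 s u = d * (u_star h u - s)"
proof
  define E where "E = exp (h * (u + 1))"
  have E1: "1 < E" using assms by (simp add: E_def)
  have pos: "0 < 1 + h * u - 1 / E" using E1 assms
    by (smt (verit) divide_less_eq_1_pos mult_pos_pos)
  have "exp ((1 + u) * h) = E" "exp (- ((1 + u) * h)) = 1 / E"
    by (simp_all add: E_def exp_minus inverse_eq_divide mult.commute add.commute)
  then have us: "u_star h u = u\<^sup>2 * ((E - 1 - h * u) / (1 + h * u - 1 / E))"
    unfolding u_star_def by (simp only: mult.commute[of u h])
  show "0 < E * (1 + h * u - 1 / E)" using pos E1 by simp
  show "gap h 1 s u = E * (1 + h * u - 1 / E) * (u_star h u - s)" for s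
  proof -
    have "(1 + h * u - 1 / E) * u_star h u = u\<^sup>2 * (E - 1 - h * u)" unfolding us using pos by simp
    then have "E * (1 + h * u - 1 / E) * (u_star h u - s)
        = E * (u\<^sup>2 * (E - 1 - h * u) - s * (1 + h * u - 1 / E))"
      by (simp only: right_diff_distrib[of _ "u_star h u"] mult.assoc mult.commute[of s])
        (simp add: right_diff_distrib)
    also have "\<dots> = gap h 1 s u"
      unfolding gap_def E_def[symmetric] using E1 by (simp add: field_simps)
    finally show ?thesis by simp
  qed
qed

text \<open>With \<open>F y = exp (h (1 + y))\<close>, the ratio is \<open>(F y - 1 - h y) / (h + (1 - 1 / F y) / y)\<close>. The
  numerator increases because \<open>F' > h\<close>. In the denominator the function \<open>1 - 1 / F y\<close> is concave and
  nonnegative at 0, so its quotient by \<open>y\<close> decreases.\<close>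

lemma u_star_ratio_strict_mono:
  assumes h: "0 < h" and u: "0 < u" "u < u'"
  shows "u_star h u / u < u_star h u' / u'"
proof -
  define F where "F = (\<lambda>u. exp (h * (1 + u)))"
  have Fpos: "0 < F y" for y by (simp add: F_def)
  have F1: "1 + h + h * y \<le> F y" for y
    using exp_ge_add_one_self[of "h * (1 + y)"] by (simp add: F_def algebra_simps)
  define n where "n = (\<lambda>y. F y - 1 - h * y)"
  define \<phi> where "\<phi> = (\<lambda>y. 1 - 1 / F y)"
  have ratio: "u_star h y / y = n y / (h + \<phi> y / y)" if "0 < y" for y
  proof -
    have "h + \<phi> y / y = (1 + h * y - 1 / F y) / y" using that by (simp add: \<phi>_def field_simps)
    then show ?thesis using that
      by (simp add: u_star_def n_def F_def exp_minus inverse_eq_divide power2_eq_square mult.commute)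
  qed
  have n_less: "n u < n u'"
  proof -
    have "h * (u' - u) \<le> exp (h * (u' - u)) - 1" using exp_ge_add_one_self[of "h * (u' - u)"] by linarith
    also have "\<dots> < F u * (exp (h * (u' - u)) - 1)"
      using F1[of u] h u by (simp add: less_diff_eq) (smt (verit) mult_pos_pos)
    also have "\<dots> = F u' - F u"
      by (simp add: F_def algebra_simps flip: exp_add)
    finally show ?thesis by (simp add: n_def algebra_simps)
  qed
  have n_pos: "0 < n u" using F1[of u] h by (simp add: n_def)
  have \<phi>_pos: "0 < \<phi> y" if "0 < y" for y
  proof -
    have "0 < h * y" using h that by simp
    then have "1 < F y" using F1[of y] h by linarith
    then show ?thesis by (simp add: \<phi>_def)
  qed
  \<comment> \<open>The tangent of the concave \<open>\<phi>\<close> at \<open>u\<close> lies above \<open>\<phi>\<close> and is nonnegative at 0.\<close>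
  have "\<phi> u' / u' \<le> \<phi> u / u"
  proof -
    have "(1 - h * (u' - u)) / F u \<le> exp (- (h * (u' - u))) / F u"
      using exp_ge_add_one_self[of "- (h * (u' - u))"] Fpos[of u] by (simp add: divide_right_mono)
    also have "\<dots> = 1 / F u'"
    proof -
      have "F u' = F u * exp (h * (u' - u))" by (simp add: F_def algebra_simps flip: exp_add)
      then show ?thesis by (simp add: exp_minus inverse_eq_divide)
    qed
    finally have "1 / F u - h / F u * (u' - u) \<le> 1 / F u'" by (simp add: diff_divide_distrib)
    then have tangent: "\<phi> u' \<le> \<phi> u + h / F u * (u' - u)" unfolding \<phi>_def by linarith
    have "h / F u * u \<le> \<phi> u" using F1[of u] Fpos[of u] h by (simp add: \<phi>_def field_simps)
    then have "h / F u * u * (u' - u) \<le> \<phi> u * (u' - u)" using u by (intro mult_right_mono) auto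
    moreover have "u * \<phi> u' \<le> u * (\<phi> u + h / F u * (u' - u))" using tangent u by (intro mult_left_mono) auto
    ultimately have "u * \<phi> u' \<le> u' * \<phi> u" by (simp add: algebra_simps)
    then show ?thesis using u by (simp add: field_simps)
  qed
  moreover have "0 < \<phi> u' / u'" using \<phi>_pos[of u'] u by simp
  ultimately have "n u / (h + \<phi> u / u) \<le> n u / (h + \<phi> u' / u')"
    using h n_pos by (intro divide_left_mono) (auto simp: add_pos_pos)
  also have "\<dots> < n u' / (h + \<phi> u' / u')"
    using n_less h \<open>0 < \<phi> u' / u'\<close> by (simp add: divide_strict_right_mono)
  finally show ?thesis using ratio u by simp
qed

lemma gap_continuous: "continuous_on S (\<lambda>u. gap h w s u)"
  unfolding gap_def by (intro continuous_intros)

lemma \<sigma>_crit: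
  assumes h: "0 < h"
  shows "0 < \<sigma>_crit h" "u_star h ((\<sigma>_crit h)\<^sup>2) = (\<sigma>_crit h)\<^sup>2"
proof -
  \<comment> \<open>The equation \<open>u_star h u = u\<close>, divided by \<open>u\<close> and cleared of its denominator, extends
      continuously to \<open>u = 0\<close>.\<close>
  define k where "k = (\<lambda>u. u * (exp (h * (1 + u)) - 1 - h * u) - (1 + h * u - exp (- (h * (1 + u)))))"
  \<comment> \<open>Large enough for \<open>B\<close> times the quadratic Taylor term of the exponential to be at least 1.\<close>
  define B where "B = 1 + 2 / h\<^sup>2"
  have B: "1 \<le> B" "2 \<le> B * h\<^sup>2" using h by (auto simp: B_def field_simps)
  have "0 \<le> k B"
  proof -
    define X Q where "X = exp (h * (1 + B)) - 1 - h * B" and "Q = (h * (1 + B))\<^sup>2 / 2"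
    have "h + Q \<le> X"
      using exp_lower_Taylor_quadratic[of "h * (1 + B)"] h B by (simp add: X_def Q_def distrib_left)
    then have "B * (h + Q) \<le> B * X" using B by (intro mult_left_mono) auto
    then have "h * B + B * Q \<le> B * X" by (simp add: distrib_left mult.commute)
    moreover have "1 \<le> B * Q"
    proof -
      have "2 * 1 \<le> (B * h\<^sup>2) * (1 + B)\<^sup>2" using B by (intro mult_mono) (auto simp: one_le_power)
      then show ?thesis by (simp add: Q_def power_mult_distrib)
    qed
    moreover have "0 < exp (- (h * (1 + B)))" by simp
    moreover have "k B = B * X - (1 + h * B - exp (- (h * (1 + B))))" by (simp add: k_def X_def)
    ultimately show ?thesis by linarith
  qed
  moreover have k0: "k 0 < 0" using h by (simp add: k_def)
  ultimately obtain x where x: "0 \<le> x" "k x = 0"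
    using IVT'[of k 0 0 B] B unfolding k_def by (force intro!: continuous_intros)
  have xpos: "0 < x" using x k0 by (cases "x = 0") auto
  have "0 < h * x" using h xpos by simp
  moreover have "exp (- (h * (1 + x))) < 1" using h xpos by simp
  ultimately have "1 + h * x - exp (- (h * (1 + x))) \<noteq> 0" by linarith
  moreover have "x * (exp (h * (1 + x)) - 1 - h * x) = 1 + h * x - exp (- (h * (1 + x)))"
    using x(2) by (simp add: k_def)
  ultimately have "x * ((exp (h * (1 + x)) - 1 - h * x) / (1 + h * x - exp (- (h * (1 + x))))) = 1"
    by (simp only: times_divide_eq_right divide_self not_False_eq_True)
  moreover have "u_star h x
      = x * (x * ((exp (h * (1 + x)) - 1 - h * x) / (1 + h * x - exp (- (h * (1 + x))))))"
    by (simp only: u_star_def power2_eq_square mult.assoc mult.commute[of "1 + x" h] mult.commute[of x h])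
  ultimately have fix_x: "u_star h x = x" by (simp only: mult_1_right)
  have "\<sigma> = sqrt x" if "0 < \<sigma>" "u_star h (\<sigma>\<^sup>2) = \<sigma>\<^sup>2" for \<sigma>
  proof -
    have "\<not> \<sigma>\<^sup>2 < x" "\<not> x < \<sigma>\<^sup>2"
      using u_star_ratio_strict_mono[OF h, of "\<sigma>\<^sup>2" x] u_star_ratio_strict_mono[OF h, of x "\<sigma>\<^sup>2"]
        that fix_x xpos by auto
    then show ?thesis using that by (simp add: real_sqrt_unique)
  qed
  then have "\<exists>!\<sigma>. 0 < \<sigma> \<and> u_star h (\<sigma>\<^sup>2) = \<sigma>\<^sup>2" using xpos fix_x by (intro ex1I[of _ "sqrt x"]) auto
  from theI'[OF this] show "0 < \<sigma>_crit h" "u_star h ((\<sigma>_crit h)\<^sup>2) = (\<sigma>_crit h)\<^sup>2"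
    by (simp_all add: \<sigma>_crit_def)
qed

lemma u_star_le_iff_\<sigma>_crit:
  assumes "0 < h" "0 < \<sigma>"
  shows "u_star h (\<sigma>\<^sup>2) \<le> \<sigma>\<^sup>2 \<longleftrightarrow> \<sigma> \<le> \<sigma>_crit h"
proof -
  note c = \<sigma>_crit[OF assms(1)]
  note mono = u_star_ratio_strict_mono[OF assms(1)]
  consider "\<sigma> < \<sigma>_crit h" | "\<sigma> = \<sigma>_crit h" | "\<sigma>_crit h < \<sigma>" by linarith
  then show ?thesis
  proof cases
    case 1
    then have "\<sigma>\<^sup>2 < (\<sigma>_crit h)\<^sup>2" using assms by (simp add: power_strict_mono)
    then show ?thesis using mono[of "\<sigma>\<^sup>2" "(\<sigma>_crit h)\<^sup>2"] 1 assms c by (simp add: divide_less_eq)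
  next
    case 2
    then show ?thesis using c by simp
  next
    case 3
    then have "(\<sigma>_crit h)\<^sup>2 < \<sigma>\<^sup>2" using c by (simp add: power_strict_mono)
    then show ?thesis using mono[of "(\<sigma>_crit h)\<^sup>2" "\<sigma>\<^sup>2"] 3 assms c by (simp add: less_divide_eq)
  qed
qed

text \<open>For \<open>w < 0\<close> already \<open>gap h w s (-w)\<close> is negative. For \<open>w = 0\<close> it vanishes, and the first
  order term \<open>- 2 h s u\<close> decides.\<close>

lemma gap_neg_left:
  assumes "0 < h" "0 < s" "w \<le> 0"
  obtains u where "-w < u" "gap h w s u < 0"
proof -
  have "eventually (\<lambda>u. gap h w s u < 0) (at_right (-w))"
  proof (cases "w = 0")
    case True
    then show ?thesis unfolding gap_def using assms by simp real_asymp
  next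
    case False
    have "isCont (\<lambda>u. gap h w s u) (-w)" unfolding gap_def by (intro continuous_intros)
    then have "((\<lambda>u. gap h w s u) \<longlongrightarrow> gap h w s (-w)) (at_right (-w))"
      by (simp add: isCont_def filterlim_at_split)
    moreover have "gap h w s (-w) < 0"
    proof -
      have "gap h w s (-w) = h * w * (s + w\<^sup>2)" by (simp add: gap_def algebra_simps)
      moreover have "0 < s + w\<^sup>2" using assms by (simp add: add_pos_nonneg)
      moreover have "h * w < 0" using assms False by (simp add: mult_pos_neg)
      ultimately show ?thesis by (metis mult_neg_pos)
    qed
    ultimately show ?thesis by (rule order_tendstoD)
  qed
  moreover have "eventually (\<lambda>u. -w < u) (at_right (-w))" by (simp add: eventually_at_right_less)
  ultimately have "eventually (\<lambda>u. -w < u \<and> gap h w s u < 0) (at_right (-w))"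
    by eventually_elim simp
  then show ?thesis using that eventually_happens[of _ "at_right (-w)"] by auto
qed

lemma gap_root_exists:
  assumes "0 < h" "0 < s" "w \<le> 0"
  shows "\<exists>u. -w < u \<and> gap h w s u = 0"
proof -
  obtain a where a: "-w < a" "gap h w s a < 0" using gap_neg_left[OF assms] .
  have "filterlim (\<lambda>u. gap h w s u) at_top at_top"
    unfolding gap_def using assms by real_asymp
  then have "eventually (\<lambda>u. 0 \<le> gap h w s u \<and> a \<le> u) at_top"
    by (intro eventually_conj eventually_ge_at_top) (simp add: filterlim_at_top)
  then obtain b where b: "a \<le> b" "0 \<le> gap h w s b" using eventually_happens'[OF trivial_limit_at_top_linorder] by blast
  then obtain u where "a \<le> u" "gap h w s u = 0"
    using IVT'[of "gap h w s" a 0 b] a gap_continuous by force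
  then show ?thesis using a by (intro exI[of _ u]) auto
qed

lemma gap_root_exists_above_\<sigma>_crit:
  assumes h: "0 < h" and \<sigma>: "\<sigma>_crit h < \<sigma>"
  shows "\<exists>u>0. u < \<sigma>\<^sup>2 \<and> gap h 1 (\<sigma>\<^sup>2) u = 0"
proof -
  have s: "0 < \<sigma>" using \<sigma>_crit(1)[OF h] \<sigma> by simp
  obtain d where "0 < d" "gap h 1 (\<sigma>\<^sup>2) (\<sigma>\<^sup>2) = d * (u_star h (\<sigma>\<^sup>2) - \<sigma>\<^sup>2)"
    using u_star_gap[OF h, of "\<sigma>\<^sup>2"] s by (metis zero_less_power)
  then have pos: "0 < gap h 1 (\<sigma>\<^sup>2) (\<sigma>\<^sup>2)" using u_star_le_iff_\<sigma>_crit[OF h s] \<sigma> by simp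
  moreover have neg: "gap h 1 (\<sigma>\<^sup>2) 0 < 0" using h s by (simp add: gap_def)
  ultimately obtain u where u: "0 \<le> u" "u \<le> \<sigma>\<^sup>2" "gap h 1 (\<sigma>\<^sup>2) u = 0"
    using IVT'[of "gap h 1 (\<sigma>\<^sup>2)" 0 0 "\<sigma>\<^sup>2"] gap_continuous s by force
  moreover have "u \<noteq> 0" "u \<noteq> \<sigma>\<^sup>2" using u neg pos by auto
  ultimately show ?thesis by (intro exI[of _ u]) auto
qed

section \<open>The constant factor\<close>

text \<open>With \<open>t = - lambert_m1 (- exp (h w - 1))\<close> the Lambert equation is \<open>t - ln t = 1 - h w\<close>. The
  upper bound comes from \<open>ln t = 2 ln (sqrt t) \<le> 2 (sqrt t - 1)\<close>, so that
  \<open>(sqrt t - 1)\<^sup>2 \<le> t - 1 - ln t\<close>. It is sharp enough to give the behaviour of \<open>K_factor (-1)\<close> at 0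
  and at infinity.\<close>

lemma K_factor_nonpos:
  assumes h: "0 < h" and w: "w \<le> 0"
  obtains t where "1 - h * w \<le> t" "t \<le> (1 + sqrt (- (h * w)))\<^sup>2" "t - ln t = 1 - h * w" "K_factor w h = h / t"
proof -
  define a where "a = - (h * w)"
  have a: "0 \<le> a" using h w by (simp add: a_def mult_nonneg_nonpos)
  define B where "B = (1 + sqrt a)\<^sup>2"
  have B1: "1 \<le> B" using a by (simp add: B_def one_le_power)
  have "ln B \<le> 2 * sqrt a"
    using ln_add_one_self_le_self[of "sqrt a"] a by (simp add: B_def ln_realpow)
  moreover have "B = 1 + 2 * sqrt a + a" using a by (simp add: B_def power2_eq_square algebra_simps)
  ultimately have "1 + a \<le> B - ln B" by simp
  then obtain t where t: "1 \<le> t" "t \<le> B" "t - ln t = 1 + a"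
    using IVT'[of "\<lambda>t. t - ln t" 1 "1 + a" B] a B1 by (force intro!: continuous_intros)
  have inj: "x = y" if "1 \<le> x" "x \<le> y" "x * exp (-x) = y * exp (-y)" for x y :: real
  proof -
    have pos: "0 < x" "0 < y" using that by auto
    have "ln (x * exp (-x)) = ln (y * exp (-y))" using that(3) by simp
    then have "ln x - x = ln y - y" using pos by (simp add: ln_mult)
    then have "y - x = ln (y / x)" using pos by (simp add: ln_div)
    moreover have "y / x - 1 \<le> y - x"
    proof -
      have "(y - x) / x \<le> y - x" using that by (simp add: divide_le_eq mult_le_cancel_left1)
      then show ?thesis using that by (simp add: diff_divide_distrib)
    qed
    moreover have "ln (y / x) \<le> y / x - 1" using that by (intro ln_le_minus_one) auto
    ultimately have "ln (y / x) = y / x - 1" by linarith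
    then have "y / x = 1" using that by (intro ln_eq_minus_one) auto
    then show ?thesis using that by simp
  qed
  have val: "t * exp (-t) = exp (- a - 1)"
  proof -
    have "- a - 1 = ln t - t" using t by simp
    then have "exp (- a - 1) = exp (ln t) / exp t" by (simp only: exp_diff)
    then show ?thesis using t by (simp add: exp_minus inverse_eq_divide)
  qed
  have "lambert_m1 (- exp (h * w - 1)) = - t"
    unfolding lambert_m1_def
  proof (rule the_equality)
    show "- t \<le> - 1 \<and> - t * exp (- t) = - exp (h * w - 1)" using t val by (simp add: a_def)
    fix u assume u: "u \<le> - 1 \<and> u * exp u = - exp (h * w - 1)"
    then have "(-u) * exp (- (-u)) = t * exp (- t)" using val by (simp add: a_def)
    then show "u = - t" using inj[of "-u" t] inj[of t "-u"] u t by (cases "-u \<le> t") auto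
  qed
  then have "K_factor w h = h / t" using w by (simp add: K_factor_def)
  moreover have "1 + a \<le> t" using t ln_ge_zero[of t] by linarith
  ultimately show thesis using that[of t] t by (simp add: a_def B_def)
qed

lemma K_factor_0:
  assumes "0 < h" shows "K_factor 0 h = h"
  using K_factor_nonpos[OF assms, of 0] by (metis add.right_neutral diff_zero div_by_1 dual_order.antisym
      minus_zero mult_zero_right one_power2 order_refl real_sqrt_zero)

lemma K_factor_neg1_bounds:
  assumes "0 < h"
  shows "h / (1 + sqrt h)\<^sup>2 \<le> K_factor (-1) h" "K_factor (-1) h \<le> h / (1 + h)"
proof -
  obtain t where t: "1 + h \<le> t" "t \<le> (1 + sqrt h)\<^sup>2" "K_factor (-1) h = h / t"
    using K_factor_nonpos[OF assms, of "-1"] by auto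
  then show "h / (1 + sqrt h)\<^sup>2 \<le> K_factor (-1) h" "K_factor (-1) h \<le> h / (1 + h)"
    using assms by (auto intro!: divide_left_mono mult_pos_pos)
qed

lemma K_factor_neg1_asymp: "K_factor (-1) \<sim>[at_right 0] (\<lambda>h. h)"
proof (rule asymp_equivI')
  show "((\<lambda>h. K_factor (-1) h / h) \<longlongrightarrow> 1) (at_right 0)"
  proof (rule tendsto_sandwich)
    show "\<forall>\<^sub>F h in at_right 0. 1 / (1 + sqrt h)\<^sup>2 \<le> K_factor (-1) h / h"
      using eventually_at_right_less
      by eventually_elim (use K_factor_neg1_bounds in \<open>simp add: field_simps\<close>)
    show "\<forall>\<^sub>F h in at_right 0. K_factor (-1) h / h \<le> 1 / (1 + h)"
      using eventually_at_right_less
      by eventually_elim (use K_factor_neg1_bounds in \<open>simp add: field_simps\<close>)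
    show "((\<lambda>h::real. 1 / (1 + sqrt h)\<^sup>2) \<longlongrightarrow> 1) (at_right 0)" by real_asymp
    show "((\<lambda>h::real. 1 / (1 + h)) \<longlongrightarrow> 1) (at_right 0)" by real_asymp
  qed
qed

lemma K_factor_neg1_at_top: "(K_factor (-1) \<longlongrightarrow> 1) at_top"
proof (rule tendsto_sandwich)
  show "\<forall>\<^sub>F h in at_top. h / (1 + sqrt h)\<^sup>2 \<le> K_factor (-1) h"
    using eventually_gt_at_top[of 0] by eventually_elim (rule K_factor_neg1_bounds)
  show "\<forall>\<^sub>F h in at_top. K_factor (-1) h \<le> h / (1 + h)"
    using eventually_gt_at_top[of 0] by eventually_elim (rule K_factor_neg1_bounds)
  show "((\<lambda>h::real. h / (1 + sqrt h)\<^sup>2) \<longlongrightarrow> 1) at_top" by real_asymp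
  show "((\<lambda>h::real. h / (1 + h)) \<longlongrightarrow> 1) at_top" by real_asymp
qed

text \<open>The quotient of the tilted mean by the variance \<open>u v\<close> is \<open>(E - 1) / (v + u E)\<close> with
  \<open>E = exp (h (u + w))\<close>, which decreases in \<open>v\<close>. For \<open>w = 1\<close> the least possible \<open>v\<close> is 1. For
  \<open>w \<le> 0\<close> the bound at \<open>v = 0\<close> is \<open>(1 - 1 / E) / u\<close>; its supremum over \<open>u\<close> is \<open>h / t\<close>, by the
  inequality \<open>1 + x \<le> exp x\<close> at \<open>x = t - 1 - h u\<close>, with \<open>t\<close> the Lambert root.\<close>

lemma two_point_mean_less_K_factor:
  assumes h: "0 < h" and w: "w \<le> 0 \<or> w = 1" and uv: "0 < u" "0 < v" "-u < w" "w \<le> v"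
  shows "two_point_mean h w u v < K_factor w h * (u * v)"
proof -
  define E where "E = exp (h * (u + w))"
  have E1: "1 < E" using h uv by (simp add: E_def)
  have den: "0 < v + u * E" using uv E1 by (simp add: add_pos_pos)
  have "(E - 1) / (v + u * E) < K_factor w h"
  proof (cases "w = 1")
    case True
    have "E - 1 < (exp h - 1) * (1 + u * E)"
    proof -
      have "1 - exp (- (h * u)) \<le> h * u" using exp_ge_add_one_self[of "- (h * u)"] by simp
      also have "\<dots> < (exp h - 1) * u" using exp_gt_one[OF h] uv h exp_ge_add_one_self[of h]
          exp_minus_greater[of "-h"] by simp
      finally have "E * (1 - exp (- (h * u))) < E * ((exp h - 1) * u)" using E1 by simp
      moreover have "E * exp (- (h * u)) = exp h" by (simp add: E_def True algebra_simps flip: exp_add)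
      ultimately show ?thesis by (simp add: algebra_simps)
    qed
    also have "\<dots> \<le> (exp h - 1) * (v + u * E)" using uv True h by simp
    finally show ?thesis using den True by (simp add: K_factor_def divide_less_eq)
  next
    case False
    then have "w \<le> 0" using w by simp
    with h obtain t where t: "1 - h * w \<le> t" "t - ln t = 1 - h * w" "K_factor w h = h / t"
      by (rule K_factor_nonpos)
    have tpos: "0 < t" using t(1) h \<open>w \<le> 0\<close> by (smt (verit) mult_nonneg_nonpos)
    have "1 / E = exp (t - 1 - h * u) / t"
    proof -
      have "- (h * (u + w)) = t - 1 - h * u - ln t" using t(2) by (simp add: algebra_simps)
      then have "exp (- (h * (u + w))) = exp (t - 1 - h * u) / exp (ln t)" by (simp add: exp_diff)
      then show ?thesis using tpos by (simp add: E_def exp_minus inverse_eq_divide)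
    qed
    also have "\<dots> \<ge> (t - h * u) / t"
      using exp_ge_add_one_self[of "t - 1 - h * u"] tpos by (intro divide_right_mono) auto
    finally have "1 - 1 / E \<le> h / t * u" using tpos by (simp add: field_simps)
    have "(E - 1) / (v + u * E) < (E - 1) / (u * E)"
      using uv E1 by (intro divide_strict_left_mono) (auto intro!: mult_pos_pos add_pos_pos)
    also have "\<dots> = (1 - 1 / E) / u" using E1 uv by (simp add: field_simps)
    also have "\<dots> \<le> h / t" using \<open>1 - 1 / E \<le> h / t * u\<close> uv by (simp add: divide_le_eq)
    finally show ?thesis using t by simp
  qed
  then have "(E - 1) / (v + u * E) * (u * v) < K_factor w h * (u * v)"
    by (rule mult_strict_right_mono) (use uv in simp)
  then show ?thesis by (simp add: two_point_mean_def E_def[symmetric] mult_ac)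
qed

text \<open>The strict estimates of the previous lemma become equalities in the limit: for \<open>w = 1\<close> take
  \<open>v = 1\<close> and \<open>u \<rightarrow> 0\<close>; for \<open>w < 0\<close> take the maximising \<open>u = (t - 1) / h\<close> and \<open>v \<rightarrow> 0\<close>; for
  \<open>w = 0\<close> that \<open>u\<close> is 0, so a small \<open>u\<close> is chosen first and then \<open>v \<rightarrow> 0\<close>.\<close>

lemma K_factor_sharp:
  assumes h: "0 < h" and w: "w \<le> 0 \<or> w = 1" and K: "K < K_factor w h"
  obtains u v where "0 < u" "0 < v" "-u < w" "w \<le> v" "K * (u * v) < two_point_mean h w u v"
proof -
  have "\<exists>u v. 0 < u \<and> 0 < v \<and> -u < w \<and> w \<le> v
      \<and> K < (exp (h * (u + w)) - 1) / (v + u * exp (h * (u + w)))"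
  proof (cases "w = 1")
    case True
    have "((\<lambda>u. (exp (h * (u + 1)) - 1) / (1 + u * exp (h * (u + 1)))) \<longlongrightarrow> exp h - 1) (at_right 0)"
      by (auto intro!: tendsto_eq_intros)
    then have "\<forall>\<^sub>F u in at_right 0. K < (exp (h * (u + 1)) - 1) / (1 + u * exp (h * (u + 1)))"
      using K True by (intro order_tendstoD) (auto simp: K_factor_def)
    then have "\<forall>\<^sub>F u in at_right 0. 0 < u \<and> K < (exp (h * (u + 1)) - 1) / (1 + u * exp (h * (u + 1)))"
      using eventually_at_right_less[of "0::real"] by eventually_elim simp
    then obtain u where "0 < u" "K < (exp (h * (u + 1)) - 1) / (1 + u * exp (h * (u + 1)))"
      using eventually_happens[of _ "at_right (0::real)"] by auto
    then show ?thesis using True by (intro exI[of _ u] exI[of _ 1]) auto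
  next
    case False
    then have w0: "w \<le> 0" using w by simp
    obtain u where u: "0 < u" "-u < w" "K < (1 - exp (- (h * (u + w)))) / u"
    proof (cases "w = 0")
      case True
      have "((\<lambda>u. (1 - exp (- (h * u))) / u) \<longlongrightarrow> h) (at_right 0)" using h by real_asymp
      then have "\<forall>\<^sub>F u in at_right 0. K < (1 - exp (- (h * u))) / u"
        using K True K_factor_0[OF h] by (intro order_tendstoD) auto
      then have "\<forall>\<^sub>F u in at_right 0. 0 < u \<and> K < (1 - exp (- (h * u))) / u"
        using eventually_at_right_less[of "0::real"] by eventually_elim simp
      then obtain u where "0 < u" "K < (1 - exp (- (h * u))) / u"
        using eventually_happens[of _ "at_right (0::real)"] by auto
      then show thesis using that[of u] True by simp
    next
      case False
      obtain t where t: "1 - h * w \<le> t" "t - ln t = 1 - h * w" "K_factor w h = h / t"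
        using h w0 by (rule K_factor_nonpos)
      have "h * w < 0" using h w0 False by (simp add: mult_pos_neg)
      then have t1: "1 < t" using t(1) by linarith
      \<comment> \<open>The \<open>u\<close> with equality in \<open>1 + x \<le> exp x\<close> at \<open>x = t - 1 - h u\<close>.\<close>
      define u where "u = (t - 1) / h"
      have hu: "h * u = t - 1" using h by (simp add: u_def)
      have "0 < h * (u + w)" using hu t(2) ln_gt_zero[OF t1] by (simp add: algebra_simps)
      then have uw: "-u < w" using h by (simp add: zero_less_mult_iff)
      have "h * (u + w) = ln t" using hu t(2) by (simp add: algebra_simps)
      then have "(1 - exp (- (h * (u + w)))) / u = h / t"
        using t1 h by (simp add: exp_minus u_def field_simps)
      then show thesis using that[of u] uw w0 K t(3) by simp
    qed
    define E where "E = exp (h * (u + w))"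
    have "((\<lambda>v. (E - 1) / (v + u * E)) \<longlongrightarrow> (E - 1) / (0 + u * E)) (at_right 0)"
      using u by (intro tendsto_intros) (auto simp: E_def)
    moreover have "(E - 1) / (0 + u * E) = (1 - exp (- (h * (u + w)))) / u"
    proof -
      have "exp (- (h * (u + w))) = 1 / E" by (simp add: E_def exp_minus inverse_eq_divide)
      moreover have "0 < E" by (simp add: E_def)
      ultimately show ?thesis using u by (simp add: field_simps)
    qed
    ultimately have "\<forall>\<^sub>F v in at_right 0. K < (E - 1) / (v + u * E)"
      using u by (intro order_tendstoD) auto
    then have "\<forall>\<^sub>F v in at_right 0. 0 < v \<and> K < (E - 1) / (v + u * E)"
      using eventually_at_right_less[of "0::real"] by eventually_elim simp
    then obtain v where "0 < v" "K < (E - 1) / (v + u * E)"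
      using eventually_happens[of _ "at_right (0::real)"] by auto
    then show ?thesis using u w0 by (intro exI[of _ u] exI[of _ v]) (auto simp: E_def)
  qed
  then obtain u v where uv: "0 < u" "0 < v" "-u < w" "w \<le> v"
    "K < (exp (h * (u + w)) - 1) / (v + u * exp (h * (u + w)))" by blast
  from uv(5) have "K * (u * v) < (exp (h * (u + w)) - 1) / (v + u * exp (h * (u + w))) * (u * v)"
    by (rule mult_strict_right_mono) (use uv in simp)
  then show thesis using that[of u v] uv by (simp add: two_point_mean_def mult_ac)
qed

section \<open>The extremal distribution\<close>

text \<open>The hypotheses of \<open>two_point_optimal\<close> along the curve \<open>u v = \<sigma>\<^sup>2\<close>. The equation
  \<open>\<sigma>\<^sup>2 / u = w\<close> is the case in which the upper atom sits at the kink, which happens only for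
  \<open>w > 0\<close>.\<close>

definition extremal :: "real \<Rightarrow> real \<Rightarrow> real \<Rightarrow> real \<Rightarrow> bool" where
  "extremal h w \<sigma> u \<longleftrightarrow> 0 < u \<and> -u < w \<and> w \<le> \<sigma>\<^sup>2 / u \<and>
     gap h w (\<sigma>\<^sup>2) u \<le> 0 \<and> (\<sigma>\<^sup>2 / u = w \<or> gap h w (\<sigma>\<^sup>2) u = 0)"

lemma extremal_optimal:
  assumes h: "0 < h" and \<sigma>: "0 < \<sigma>" and ext: "extremal h w \<sigma> u"
    and P: "P \<in> moment_class_le \<sigma>"
  shows "wt_mean h w P \<le> wt_mean h w (two_point u (\<sigma>\<^sup>2 / u))"
    and "wt_mean h w P = wt_mean h w (two_point u (\<sigma>\<^sup>2 / u)) \<Longrightarrow> P = two_point u (\<sigma>\<^sup>2 / u)"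
proof -
  have u: "0 < u" "0 < \<sigma>\<^sup>2 / u" "-u < w" "w \<le> \<sigma>\<^sup>2 / u" and prod: "u * (\<sigma>\<^sup>2 / u) = \<sigma>\<^sup>2"
    using ext \<sigma> by (auto simp: extremal_def)
  have gap: "gap h w (u * (\<sigma>\<^sup>2 / u)) u \<le> 0" "\<sigma>\<^sup>2 / u = w \<or> gap h w (u * (\<sigma>\<^sup>2 / u)) u = 0"
    using ext unfolding prod extremal_def by auto
  show "wt_mean h w P \<le> wt_mean h w (two_point u (\<sigma>\<^sup>2 / u))"
    and "wt_mean h w P = wt_mean h w (two_point u (\<sigma>\<^sup>2 / u)) \<Longrightarrow> P = two_point u (\<sigma>\<^sup>2 / u)"
    using two_point_optimal[OF h u gap prod P] by (simp_all add: wt_mean_two_point[OF u])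
qed

lemma moment_class_subset_le: "0 < \<sigma> \<Longrightarrow> moment_class \<sigma> \<subseteq> moment_class_le \<sigma>"
  by (auto simp: moment_class_def moment_class_le_def)

lemma extremal_in_moment_class:
  assumes "0 < \<sigma>" "extremal h w \<sigma> u"
  shows "two_point u (\<sigma>\<^sup>2 / u) \<in> moment_class \<sigma>"
  using assms by (intro two_point_in_moment_class) (auto simp: extremal_def)

text \<open>Two extremal parameters give two optimal distributions, and there is only one. Hence the
  stationarity equation has at most one admissible root, although \<open>gap\<close> need not be monotone.\<close>

lemma extremal_unique:
  assumes h: "0 < h" and \<sigma>: "0 < \<sigma>" and ext: "extremal h w \<sigma> u" "extremal h w \<sigma> u'"
  shows "u = u'"
proof -
  note mem = subsetD[OF moment_class_subset_le[OF \<sigma>] extremal_in_moment_class[OF \<sigma>]]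
  have "wt_mean h w (two_point u' (\<sigma>\<^sup>2 / u')) = wt_mean h w (two_point u (\<sigma>\<^sup>2 / u))"
    using extremal_optimal(1)[OF h \<sigma> ext(1) mem[OF ext(2)]]
      extremal_optimal(1)[OF h \<sigma> ext(2) mem[OF ext(1)]] by simp
  from extremal_optimal(2)[OF h \<sigma> ext(1) mem[OF ext(2)] this] show ?thesis
    using two_point_inject[of u' "\<sigma>\<^sup>2 / u'" u "\<sigma>\<^sup>2 / u"] ext \<sigma> by (auto simp: extremal_def)
qed

text \<open>Where \<open>\<epsilon>_opt\<close> is a root, its existence comes from the intermediate value theorem and its
  uniqueness from \<open>extremal_unique\<close>. For \<open>w = 1\<close> and \<open>\<sigma> \<le> \<sigma>_crit h\<close> the upper atom is at the
  kink instead, and \<open>u_star h (\<sigma>\<^sup>2) \<le> \<sigma>\<^sup>2\<close> is exactly the inequality required there.\<close>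

lemma extremal_\<epsilon>_opt:
  assumes h: "0 < h" and \<sigma>: "0 < \<sigma>" and w: "w \<le> 0 \<or> w = 1"
  shows "extremal h w \<sigma> (\<epsilon>_opt h w \<sigma>)"
proof (cases "w = 1")
  case w1: True
  show ?thesis
  proof (cases "\<sigma> \<le> \<sigma>_crit h")
    case True
    obtain d where d: "0 < d" "gap h 1 (\<sigma>\<^sup>2) (\<sigma>\<^sup>2) = d * (u_star h (\<sigma>\<^sup>2) - \<sigma>\<^sup>2)"
      using u_star_gap[OF h, of "\<sigma>\<^sup>2"] \<sigma> by (metis zero_less_power)
    then have "gap h 1 (\<sigma>\<^sup>2) (\<sigma>\<^sup>2) \<le> 0"
      using True u_star_le_iff_\<sigma>_crit[OF h \<sigma>] by (simp add: mult_nonneg_nonpos)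
    moreover have "0 < \<sigma>\<^sup>2" "-1 < \<sigma>\<^sup>2" using zero_less_power[OF \<sigma>, of 2] by linarith+
    ultimately have "extremal h 1 \<sigma> (\<sigma>\<^sup>2)" unfolding extremal_def by auto
    then show ?thesis using True w1 by (simp add: \<epsilon>_opt_def)
  next
    case False
    then have crit: "\<sigma>_crit h < \<sigma>" by simp
    have iff: "0 < u \<and> u < \<sigma>\<^sup>2 \<and> u_star h u = \<sigma>\<^sup>2 \<longleftrightarrow> 0 < u \<and> u < \<sigma>\<^sup>2 \<and> gap h 1 (\<sigma>\<^sup>2) u = 0" for u
    proof (cases "0 < u")
      case True
      obtain d where "0 < d" "gap h 1 (\<sigma>\<^sup>2) u = d * (u_star h u - \<sigma>\<^sup>2)"
        using u_star_gap[OF h True] by metis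
      then show ?thesis by simp
    qed simp
    have ext: "extremal h 1 \<sigma> u" if "0 < u \<and> u < \<sigma>\<^sup>2 \<and> u_star h u = \<sigma>\<^sup>2" for u
      using that unfolding iff by (auto simp: extremal_def)
    have "\<exists>!u. 0 < u \<and> u < \<sigma>\<^sup>2 \<and> u_star h u = \<sigma>\<^sup>2"
      using gap_root_exists_above_\<sigma>_crit[OF h crit, folded iff] extremal_unique[OF h \<sigma>] ext by blast
    from ext[OF theI'[OF this]] show ?thesis
      using False w1 by (simp add: \<epsilon>_opt_def \<epsilon>_tilde_def)
  qed
next
  case False
  then have w0: "w \<le> 0" using w by simp
  have eqn: "exp ((u + w) * h) * (1 + u * h) * (u\<^sup>2 + \<sigma>\<^sup>2) - u\<^sup>2 * exp (2 * (u + w) * h) - \<sigma>\<^sup>2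
      = - gap h w (\<sigma>\<^sup>2) u" for u
  proof -
    have "exp (2 * (u + w) * h) = (exp (h * (u + w)))\<^sup>2"
      by (simp add: exp_double[symmetric] mult_ac)
    then show ?thesis unfolding gap_def
      by (simp add: power2_eq_square mult.commute[of "u + w" h] algebra_simps del: exp_add)
  qed
  have iff: "\<bar>w\<bar> < u \<and> exp ((u + w) * h) * (1 + u * h) * (u\<^sup>2 + \<sigma>\<^sup>2) - u\<^sup>2 * exp (2 * (u + w) * h) - \<sigma>\<^sup>2 = 0
      \<longleftrightarrow> -w < u \<and> gap h w (\<sigma>\<^sup>2) u = 0" for u
    unfolding eqn using w0 by auto
  have ext: "extremal h w \<sigma> u" if "-w < u \<and> gap h w (\<sigma>\<^sup>2) u = 0" for u
  proof -
    have "0 < u" using that w0 by simp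
    then have "w \<le> \<sigma>\<^sup>2 / u" using w0 by (intro order.trans[OF w0]) simp
    then show ?thesis using that \<open>0 < u\<close> by (auto simp: extremal_def)
  qed
  have "\<exists>!u. -w < u \<and> gap h w (\<sigma>\<^sup>2) u = 0"
    using gap_root_exists[OF h _ w0, of "\<sigma>\<^sup>2"] \<sigma> extremal_unique[OF h \<sigma>] ext
    by (metis zero_less_power)
  from ext[OF theI'[OF this]] show ?thesis
    using False unfolding \<epsilon>_opt_def iff by simp
qed

lemma extremal_attain:
  assumes h: "0 < h" and \<sigma>: "0 < \<sigma>" and ext: "extremal h w \<sigma> u"
    and C: "C \<subseteq> moment_class_le \<sigma>" "two_point u (\<sigma>\<^sup>2 / u) \<in> C"
  shows "wt_sup h w C = ereal (wt_mean h w (two_point u (\<sigma>\<^sup>2 / u)))"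
    and "wt_attain h w C = {two_point u (\<sigma>\<^sup>2 / u)}"
proof -
  note opt = extremal_optimal[OF h \<sigma> ext]
  show sup: "wt_sup h w C = ereal (wt_mean h w (two_point u (\<sigma>\<^sup>2 / u)))"
    unfolding wt_sup_def
  proof (rule antisym)
    show "(SUP P\<in>C. ereal (wt_mean h w P)) \<le> ereal (wt_mean h w (two_point u (\<sigma>\<^sup>2 / u)))"
      using opt(1) C(1) by (intro SUP_least) auto
  qed (rule SUP_upper[OF C(2)])
  show "wt_attain h w C = {two_point u (\<sigma>\<^sup>2 / u)}"
    unfolding wt_attain_def sup using opt(2) C by auto
qed

lemma two_point_class_subset: "0 < \<sigma> \<Longrightarrow> two_point_class w \<sigma> \<subseteq> two_point_class_le w \<sigma>"
  by (fastforce simp: two_point_class_def two_point_class_le_def)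

lemma two_point_class_le_subset: "two_point_class_le w \<sigma> \<subseteq> moment_class_le \<sigma>"
proof
  fix P assume "P \<in> two_point_class_le w \<sigma>"
  then obtain u v where P: "P = two_point u v" and uv: "-u < w" "w \<le> v" "0 < u * v" "u * v \<le> \<sigma>\<^sup>2"
    by (auto simp: two_point_class_le_def)
  have pos: "0 < u" "0 < v" using uv by (auto simp: zero_less_mult_iff)
  have "u * v = (sqrt (u * v))\<^sup>2" using uv(3) by simp
  from two_point_in_moment_class[OF pos this] show "P \<in> moment_class_le \<sigma>"
    using uv unfolding P moment_class_def moment_class_le_def by auto
qed

theorem theorem2p4:
  fixes h \<sigma> w :: real
  assumes "0 < h" and "0 < \<sigma>" and "w \<in> {-1, 0, 1}"
  shows
    "(wt_attain h w (moment_class \<sigma>) = {two_point (\<epsilon>_opt h w \<sigma>) (\<sigma>\<^sup>2 / \<epsilon>_opt h w \<sigma>)} \<and>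
      wt_attain h w (moment_class_le \<sigma>) = {two_point (\<epsilon>_opt h w \<sigma>) (\<sigma>\<^sup>2 / \<epsilon>_opt h w \<sigma>)} \<and>
      wt_attain h w (two_point_class w \<sigma>) = {two_point (\<epsilon>_opt h w \<sigma>) (\<sigma>\<^sup>2 / \<epsilon>_opt h w \<sigma>)} \<and>
      wt_attain h w (two_point_class_le w \<sigma>) = {two_point (\<epsilon>_opt h w \<sigma>) (\<sigma>\<^sup>2 / \<epsilon>_opt h w \<sigma>)})
     \<and>
     (wt_sup h w (moment_class \<sigma>)
        = ereal (wt_mean h w (two_point (\<epsilon>_opt h w \<sigma>) (\<sigma>\<^sup>2 / \<epsilon>_opt h w \<sigma>))) \<and>
      wt_mean h w (two_point (\<epsilon>_opt h w \<sigma>) (\<sigma>\<^sup>2 / \<epsilon>_opt h w \<sigma>)) < K_factor w h * \<sigma>\<^sup>2 \<and>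
      (\<forall>h'>0. K_factor 0 h' = h') \<and>
      K_factor (-1) \<sim>[at_right 0] (\<lambda>h'. h') \<and>
      (K_factor (-1) \<longlongrightarrow> 1) at_top)
     \<and>
     (\<forall>h'>0. \<forall>w'\<in>{-1, 0, 1}.
        \<not> (\<exists>K<K_factor w' h'. \<forall>\<sigma>'>0. wt_sup h' w' (moment_class \<sigma>') \<le> ereal (K * \<sigma>'\<^sup>2)))"
proof -
  define u where "u = \<epsilon>_opt h w \<sigma>"
  have w: "w \<le> 0 \<or> w = 1" using assms(3) by auto
  have ext: "extremal h w \<sigma> u" unfolding u_def by (rule extremal_\<epsilon>_opt[OF assms(1,2) w])
  have u: "0 < u" "0 < \<sigma>\<^sup>2 / u" "-u < w" "w \<le> \<sigma>\<^sup>2 / u" and prod: "u * (\<sigma>\<^sup>2 / u) = \<sigma>\<^sup>2"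
    using ext assms(2) by (auto simp: extremal_def)
  have mem2: "two_point u (\<sigma>\<^sup>2 / u) \<in> two_point_class w \<sigma>"
    unfolding two_point_class_def using u prod by blast
  note mem = extremal_in_moment_class[OF assms(2) ext]
  note sub = moment_class_subset_le[OF assms(2)] two_point_class_subset[OF assms(2), of w]
    two_point_class_le_subset[of w \<sigma>]
  have mem_le: "two_point u (\<sigma>\<^sup>2 / u) \<in> moment_class_le \<sigma>" and mem2_le: "two_point u (\<sigma>\<^sup>2 / u) \<in> two_point_class_le w \<sigma>"
    and sub2: "two_point_class w \<sigma> \<subseteq> moment_class_le \<sigma>"
    using mem mem2 sub by blast+
  note attain = extremal_attain[OF assms(1,2) ext]
  have bound: "wt_mean h w (two_point u (\<sigma>\<^sup>2 / u)) < K_factor w h * \<sigma>\<^sup>2"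
    using two_point_mean_less_K_factor[OF assms(1) w u] unfolding wt_mean_two_point[OF u] prod .
  have sharp: "\<not> (\<exists>K<K_factor w' h'. \<forall>\<sigma>'>0. wt_sup h' w' (moment_class \<sigma>') \<le> ereal (K * \<sigma>'\<^sup>2))"
    if h': "0 < h'" and w': "w' \<in> {-1, 0, 1}" for h' w' :: real
  proof
    assume "\<exists>K<K_factor w' h'. \<forall>\<sigma>'>0. wt_sup h' w' (moment_class \<sigma>') \<le> ereal (K * \<sigma>'\<^sup>2)"
    then obtain K where K: "K < K_factor w' h'"
      and le: "\<And>\<sigma>'. 0 < \<sigma>' \<Longrightarrow> wt_sup h' w' (moment_class \<sigma>') \<le> ereal (K * \<sigma>'\<^sup>2)" by blast
    have "w' \<le> 0 \<or> w' = 1" using w' by auto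
    with h' obtain x y where xy: "0 < x" "0 < y" "-x < w'" "w' \<le> y" "K * (x * y) < two_point_mean h' w' x y"
      using K by (rule K_factor_sharp)
    define \<tau> where "\<tau> = sqrt (x * y)"
    have \<tau>: "0 < \<tau>" "x * y = \<tau>\<^sup>2" using xy by (simp_all add: \<tau>_def)
    have "ereal (two_point_mean h' w' x y) \<le> wt_sup h' w' (moment_class \<tau>)"
      unfolding wt_sup_def wt_mean_two_point[OF xy(1-4), symmetric]
      by (rule SUP_upper) (rule two_point_in_moment_class[OF xy(1,2) \<tau>(2)])
    also have "\<dots> \<le> ereal (K * \<tau>\<^sup>2)" using le \<tau>(1) by blast
    finally show False using xy(5) \<tau>(2) by simp
  qed
  show ?thesis
    unfolding u_def[symmetric]
    using attain(2)[OF sub(1) mem] attain(2)[OF order.refl mem_le] attain(2)[OF sub2 mem2]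
      attain(2)[OF sub(3) mem2_le] attain(1)[OF sub(1) mem] bound sharp
      K_factor_0 K_factor_neg1_asymp K_factor_neg1_at_top
    by blast
qed

end
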